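(* Let $d\ge2$ and $N>1$ be integers, let $M\in\{d-1,d\}$, and let $S_{\mathbf a,\mathbf b}\subset\mathbb R^d$ be the two-row Hermite normal form simplex associated with $\mathbf a=(1,\ldots,1,N)$ and $\mathbf b=(M-1,\ldots,M-1,M,0)$. Then the local $h^\ast$-polynomial is $$\ell^\ast_{S_{\mathbf a,\mathbf b}}(t)=\begin{cases}0,&\text{if }M=d-1,\\ (N-1)\displaystyle\sum_{i=1}^dt^i,&\text{if }M=d.\end{cases}$$
   Context: For $\mathbf b=(b_1,\ldots,b_{d-2},M,0)$ and $\mathbf a=(a_1,\ldots,a_{d-1},N)$ in $\mathbb Z^d$, the two-row Hermite normal form simplex $S_{\mathbf a,\mathbf b}$ is the convex hull in $\mathbb R^d$ of $\mathbf v_0=\mathbf 0$, $\mathbf v_i=\mathbf e_i$ (standard unit vectors) for $1\le i\le d-2$, $\mathbf v_{d-1}=\mathbf b$, and $\mathbf v_d=\mathbf a$. In $\mathbf b=(M-1,\ldots,M-1,M,0)$ the first $d-2$ entries equal $M-1$; in $\mathbf a=(1,\ldots,1,N)$ the first $d-1$ entries equal $1$. For a $d$-dimensional lattice simplex $S$ with vertices $\mathbf v_0,\ldots,\mathbf v_d$, let $A$ be the $(d+1)\times(d+1)$ matrix with rows $(1,\mathbf v_i)$, let $\Lambda=\mathbb Z^{d+1}A^{-1}$ (row vectors), and $\Gamma=\Lambda/\mathbb Z^{d+1}$, whose elements are identified with their unique representatives in $[0,1)^{d+1}$. For $\mathbf x\in\Gamma$ (so represented) let $\mathrm{age}(\mathbf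 x)=\sum_{i=0}^d x_i$. The local $h^\ast$-polynomial is $\ell^\ast_S(t)=\sum_{\mathbf x\in\Gamma\cap(0,1)^{d+1}}t^{\mathrm{age}(\mathbf x)}$. *)

theory Defs
  imports
    Jordan_Normal_Form.Gauss_Jordan_Elimination
    "HOL-Computational_Algebra.Polynomial"
begin

(* Points of R^n are real vectors in carrier_vec n. Library vectors are indexed from 0,
   so the j-th coordinate of the mathematical text (1 <= j <= n) is component j - 1. *)

definition integer_points :: "nat \<Rightarrow> real vec set" where
  "integer_points n = {z \<in> carrier_vec n. \<forall>i<n. z $ i \<in> \<int>}"

(* The library's convex hull operator needs a real vector space type; carrier_vec d is
   only a subset of a type, so the hull of v 0, ..., v d is written out. *)
definition vertex_hull :: "nat \<Rightarrow> (nat \<Rightarrow> real vec) \<Rightarrow> real vec set" where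
  "vertex_hull d v =
     {vec d (\<lambda>j. \<Sum>i\<le>d. c i * v i $ j) | c :: nat \<Rightarrow> real.
        (\<forall>i\<le>d. 0 \<le> c i) \<and> (\<Sum>i\<le>d. c i) = 1}"

definition affinely_independent :: "nat \<Rightarrow> (nat \<Rightarrow> real vec) \<Rightarrow> bool" where
  "affinely_independent d v \<longleftrightarrow>
     (\<forall>c :: nat \<Rightarrow> real.
        (\<Sum>i\<le>d. c i) = 0 \<and> (\<forall>j<d. (\<Sum>i\<le>d. c i * v i $ j) = 0) \<longrightarrow> (\<forall>i\<le>d. c i = 0))"

(* S is a d-dimensional lattice simplex in R^d and v 0, ..., v d enumerates its vertices;
   the values v i for i > d are irrelevant. *)
definition lattice_simplex :: "nat \<Rightarrow> real vec set \<Rightarrow> (nat \<Rightarrow> real vec) \<Rightarrow> bool" where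
  "lattice_simplex d S v \<longleftrightarrow>
     (\<forall>i\<le>d. v i \<in> integer_points d) \<and> affinely_independent d v \<and> S = vertex_hull d v"

definition vertex_matrix :: "nat \<Rightarrow> (nat \<Rightarrow> real vec) \<Rightarrow> real mat" where
  "vertex_matrix d v =
     mat (d + 1) (d + 1) (\<lambda>(i, j). if j = 0 then 1 else v i $ (j - 1))"

(* The row vector z A^{-1} is written as the transpose of A^{-1} applied to z. For affinely
   independent vertices A is invertible, so mat_inverse returns its inverse. *)
definition simplex_lattice :: "nat \<Rightarrow> (nat \<Rightarrow> real vec) \<Rightarrow> real vec set" where
  "simplex_lattice d v =
     {transpose_mat (the (mat_inverse (vertex_matrix d v))) *\<^sub>v z | z. z \<in> integer_points (d + 1)}"

(* Gamma, each class modulo Z^{d+1} being given by its representative in [0,1)^{d+1} *)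
definition simplex_group :: "nat \<Rightarrow> (nat \<Rightarrow> real vec) \<Rightarrow> real vec set" where
  "simplex_group d v = {x \<in> simplex_lattice d v. \<forall>i\<le>d. 0 \<le> x $ i \<and> x $ i < 1}"

definition age :: "nat \<Rightarrow> real vec \<Rightarrow> real" where
  "age d x = (\<Sum>i\<le>d. x $ i)"

(* The index set is finite, Gamma being a finite group. The age of x in Gamma is a natural
   number, being the first entry of the integer vector x A; so the floor only changes type. *)
definition local_h_star_of_vertices :: "nat \<Rightarrow> (nat \<Rightarrow> real vec) \<Rightarrow> int poly" where
  "local_h_star_of_vertices d v =
     (\<Sum>x \<in> {x \<in> simplex_group d v. \<forall>i\<le>d. 0 < x $ i \<and> x $ i < 1}.
        monom 1 (nat \<lfloor>age d x\<rfloor>))"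

(* The choice is harmless: reordering the vertices only permutes the coordinates of the
   elements of Gamma, which preserves ages. *)
definition local_h_star :: "nat \<Rightarrow> real vec set \<Rightarrow> int poly" where
  "local_h_star d S = local_h_star_of_vertices d (SOME v. lattice_simplex d S v)"

definition two_row_hnf_vertex :: "nat \<Rightarrow> int vec \<Rightarrow> int vec \<Rightarrow> nat \<Rightarrow> real vec" where
  "two_row_hnf_vertex d a b i =
     (if i = 0 then 0\<^sub>v d
      else if i \<le> d - 2 then unit_vec d (i - 1)
      else if i = d - 1 then map_vec real_of_int b
      else map_vec real_of_int a)"

definition two_row_hnf_simplex :: "nat \<Rightarrow> int vec \<Rightarrow> int vec \<Rightarrow> real vec set" where
  "two_row_hnf_simplex d a b = vertex_hull d (two_row_hnf_vertex d a b)"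

end

theory Submission
  imports Defs "Jordan_Normal_Form.Determinant"
begin

text \<open>A vector \<open>x\<close> lies in the lattice iff \<open>x A\<close> is integral. For the simplex at hand, comparing
  the coordinates \<open>j \<le> d - 2\<close> and \<open>d - 1\<close> of \<open>x A\<close> shows that a representative in the half-open
  cube has \<open>x\<^sub>1 = \<dots> = x\<^sub>d\<^sub>-\<^sub>1 = y\<close>, and the first entry then gives \<open>x\<^sub>0 \<equiv> (M - d + 1) y\<close> modulo 1.
  If \<open>M = d - 1\<close> this forces \<open>x\<^sub>0 = 0\<close>, so no interior points exist. If \<open>M = d\<close>, the interior
  points are \<open>(y, \<dots>, y, k / N)\<close> with \<open>d y + k / N = i\<close> for \<open>1 \<le> i \<le> d\<close> and \<open>0 < k < N\<close>, and such a
  point has age \<open>i\<close>.\<close>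

subsection \<open>The lattice of a simplex\<close>

lemma transpose_vertex_matrix_mult_index:
  assumes "x \<in> carrier_vec (d + 1)" and "j < d + 1"
  shows "(transpose_mat (vertex_matrix d v) *\<^sub>v x) $ j =
    (if j = 0 then \<Sum>i\<le>d. x $ i else \<Sum>i\<le>d. x $ i * v i $ (j - 1))"
  using assms
  by (auto simp: vertex_matrix_def scalar_prod_def atLeast0LessThan lessThan_Suc_atMost mult.commute
      intro!: sum.cong)

text \<open>A vector \<open>x\<close> with \<open>x A = 0\<close> is an affine dependence: the
  column of ones says that its entries sum to zero, the other columns that the combination of the
  vertices vanishes.\<close>

lemma det_vertex_matrix_nonzero:
  assumes "affinely_independent d v"
  shows "det (vertex_matrix d v) \<noteq> 0"
proof
  have A: "vertex_matrix d v \<in> carrier_mat (d + 1) (d + 1)"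
    by (simp add: vertex_matrix_def)
  assume "det (vertex_matrix d v) = 0"
  then have "det (transpose_mat (vertex_matrix d v)) = 0"
    using det_transpose[OF A] by simp
  then obtain x where x: "x \<in> carrier_vec (d + 1)" "x \<noteq> 0\<^sub>v (d + 1)"
    and 0: "transpose_mat (vertex_matrix d v) *\<^sub>v x = 0\<^sub>v (d + 1)"
    using det_0_iff_vec_prod_zero[of "transpose_mat (vertex_matrix d v)" "d + 1"] A by auto
  have eq: "(if j = 0 then \<Sum>i\<le>d. x $ i else \<Sum>i\<le>d. x $ i * v i $ (j - 1)) = 0"
    if "j < d + 1" for j
    using transpose_vertex_matrix_mult_index[OF x(1) that, of v] 0 that by simp
  have "(\<Sum>i\<le>d. x $ i) = 0"
    using eq[of 0] by simp
  moreover have "(\<Sum>i\<le>d. x $ i * v i $ j) = 0" if "j < d" for j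
    using eq[of "Suc j"] that by simp
  ultimately have "\<forall>i\<le>d. x $ i = 0"
    using assms unfolding affinely_independent_def by blast
  then have "x = 0\<^sub>v (d + 1)"
    using x(1) by (intro eq_vecI) auto
  with x(2) show False ..
qed

text \<open>Multiplying \<open>x = z A^{-1}\<close> by \<open>A\<close> turns membership into
  integrality of \<open>x A\<close>, so the inverse matrix never has to be computed.\<close>

lemma mem_simplex_lattice_iff:
  assumes "affinely_independent d v"
  shows "x \<in> simplex_lattice d v \<longleftrightarrow>
    x \<in> carrier_vec (d + 1) \<and> (\<Sum>i\<le>d. x $ i) \<in> \<int> \<and> (\<forall>j<d. (\<Sum>i\<le>d. x $ i * v i $ j) \<in> \<int>)"
proof -
  let ?A = "vertex_matrix d v"
  have A: "?A \<in> carrier_mat (d + 1) (d + 1)"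
    by (simp add: vertex_matrix_def)
  \<comment> \<open>This rules out the result \<open>None\<close>, so that \<open>the\<close> in
    \<open>simplex_lattice\<close> yields a genuine two-sided inverse.\<close>
  have "?A \<in> Units (ring_mat TYPE(real) (d + 1) ())"
    using A det_vertex_matrix_nonzero[OF assms] by (rule det_non_zero_imp_unit)
  then obtain B where inv: "mat_inverse ?A = Some B"
    using mat_inverse(1)[OF A, of "()"] by (cases "mat_inverse ?A") auto
  from mat_inverse(2)[OF A inv] have AB: "?A * B = 1\<^sub>m (d + 1)" and BA: "B * ?A = 1\<^sub>m (d + 1)"
    and B: "B \<in> carrier_mat (d + 1) (d + 1)"
    by auto
  have tBA: "transpose_mat ?A * transpose_mat B = 1\<^sub>m (d + 1)"
    using transpose_mult[OF B A] BA by simp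
  have tAB: "transpose_mat B * transpose_mat ?A = 1\<^sub>m (d + 1)"
    using transpose_mult[OF A B] AB by simp
  have "x \<in> simplex_lattice d v \<longleftrightarrow>
    x \<in> carrier_vec (d + 1) \<and> transpose_mat ?A *\<^sub>v x \<in> integer_points (d + 1)"
  proof
    assume "x \<in> simplex_lattice d v"
    then obtain z where z: "z \<in> integer_points (d + 1)" and x: "x = transpose_mat B *\<^sub>v z"
      by (auto simp: simplex_lattice_def inv)
    have zc: "z \<in> carrier_vec (d + 1)"
      using z by (simp add: integer_points_def)
    have "transpose_mat ?A *\<^sub>v x = (transpose_mat ?A * transpose_mat B) *\<^sub>v z"
      unfolding x using A B zc by (intro assoc_mult_mat_vec[symmetric]) auto
    then have "transpose_mat ?A *\<^sub>v x = z"
      using tBA zc by simp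
    then show "x \<in> carrier_vec (d + 1) \<and> transpose_mat ?A *\<^sub>v x \<in> integer_points (d + 1)"
      using x B zc z by auto
  next
    assume x: "x \<in> carrier_vec (d + 1) \<and> transpose_mat ?A *\<^sub>v x \<in> integer_points (d + 1)"
    have "transpose_mat B *\<^sub>v (transpose_mat ?A *\<^sub>v x) = (transpose_mat B * transpose_mat ?A) *\<^sub>v x"
      using A B x by (intro assoc_mult_mat_vec[symmetric]) auto
    then have "x = transpose_mat B *\<^sub>v (transpose_mat ?A *\<^sub>v x)"
      using tAB x by simp
    then show "x \<in> simplex_lattice d v"
      using x by (auto simp: simplex_lattice_def inv)
  qed
  also have "\<dots> \<longleftrightarrow> x \<in> carrier_vec (d + 1) \<and> (\<Sum>i\<le>d. x $ i) \<in> \<int> \<and>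
    (\<forall>j<d. (\<Sum>i\<le>d. x $ i * v i $ j) \<in> \<int>)"
  proof (rule conj_cong[OF refl])
    assume x: "x \<in> carrier_vec (d + 1)"
    have carrier: "transpose_mat ?A *\<^sub>v x \<in> carrier_vec (d + 1)"
      using A x by (intro mult_mat_vec_carrier[of _ _ "d + 1"]) auto
    have "transpose_mat ?A *\<^sub>v x \<in> integer_points (d + 1) \<longleftrightarrow>
      (\<forall>j<d + 1. (if j = 0 then \<Sum>i\<le>d. x $ i else \<Sum>i\<le>d. x $ i * v i $ (j - 1)) \<in> \<int>)"
      using transpose_vertex_matrix_mult_index[OF x, of _ v] carrier
      by (auto simp: integer_points_def simp del: index_mult_mat_vec)
    also have "\<dots> \<longleftrightarrow> (\<Sum>i\<le>d. x $ i) \<in> \<int> \<and> (\<forall>j<d. (\<Sum>i\<le>d. x $ i * v i $ j) \<in> \<int>)"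
      by (auto simp: less_Suc_eq_0_disj)
    finally show "transpose_mat ?A *\<^sub>v x \<in> integer_points (d + 1) \<longleftrightarrow>
      (\<Sum>i\<le>d. x $ i) \<in> \<int> \<and> (\<forall>j<d. (\<Sum>i\<le>d. x $ i * v i $ j) \<in> \<int>)" .
  qed
  finally show ?thesis .
qed

subsection \<open>Independence of the enumeration of the vertices\<close>

text \<open>The difference of the two coefficient families is an affine dependence. For coefficient
  sum 1 this is uniqueness of barycentric coordinates.\<close>

lemma affinely_independent_coeffs_unique:
  assumes "affinely_independent d v"
    and "(\<Sum>i\<le>d. c i) = (\<Sum>i\<le>d. c' i)"
    and "\<And>j. j < d \<Longrightarrow> (\<Sum>i\<le>d. c i * v i $ j) = (\<Sum>i\<le>d. c' i * v i $ j)"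
    and "i \<le> d"
  shows "c i = c' i"
proof -
  have "(\<Sum>i\<le>d. c i - c' i) = 0 \<and> (\<forall>j<d. (\<Sum>i\<le>d. (c i - c' i) * v i $ j) = 0)"
    using assms(2,3) by (simp add: sum_subtractf left_diff_distrib)
  then have "c i - c' i = 0"
    using assms(1,4) unfolding affinely_independent_def by blast
  then show ?thesis by simp
qed

lemma vertex_mem_hull:
  assumes "v i \<in> carrier_vec d" and "i \<le> d"
  shows "v i \<in> vertex_hull d v"
  unfolding vertex_hull_def
proof (intro CollectI exI conjI)
  show "v i = vec d (\<lambda>j. \<Sum>k\<le>d. (if k = i then 1 else 0) * v k $ j)"
    using assms by (intro eq_vecI) (auto simp: if_distrib[of "\<lambda>t. t * _"] cong: if_cong)
qed (use assms in auto)

text \<open>Choosing convex coefficients for each \<open>w i\<close> gives the rows of a stochastic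
  matrix \<open>P\<close> that carries the family \<open>v\<close> to the family
  \<open>w\<close>.\<close>

lemma hull_coefficient_matrix:
  assumes "\<And>i. i \<le> d \<Longrightarrow> w i \<in> vertex_hull d v"
  obtains P where "\<And>i j. i \<le> d \<Longrightarrow> j \<le> d \<Longrightarrow> 0 \<le> P i j"
    and "\<And>i. i \<le> d \<Longrightarrow> (\<Sum>j\<le>d. P i j) = 1"
    and "\<And>i. i \<le> d \<Longrightarrow> w i = vec d (\<lambda>l. \<Sum>j\<le>d. P i j * v j $ l)"
proof -
  have "\<forall>i. \<exists>c. i \<le> d \<longrightarrow> (\<forall>j\<le>d. 0 \<le> c j) \<and> (\<Sum>j\<le>d. c j) = 1 \<and>
    w i = vec d (\<lambda>l. \<Sum>j\<le>d. c j * v j $ l)"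
    using assms unfolding vertex_hull_def by blast
  from choice[OF this] obtain P where "\<forall>i. i \<le> d \<longrightarrow> (\<forall>j\<le>d. 0 \<le> P i j) \<and> (\<Sum>j\<le>d. P i j) = 1 \<and>
    w i = vec d (\<lambda>l. \<Sum>j\<le>d. P i j * v j $ l)" ..
  then show thesis by (intro that[of P]) blast+
qed

text \<open>The two stochastic matrices that express each vertex family through the other are mutually
  inverse, and a nonnegative matrix with nonnegative inverse is monomial.\<close>

lemma vertices_unique_up_to_permutation:
  assumes v: "affinely_independent d v" "\<And>i. i \<le> d \<Longrightarrow> v i \<in> carrier_vec d"
    and w: "affinely_independent d w" "\<And>i. i \<le> d \<Longrightarrow> w i \<in> carrier_vec d"
    and hull: "vertex_hull d v = vertex_hull d w"
  obtains p where "bij_betw p {..d} {..d}" and "\<And>i. i \<le> d \<Longrightarrow> w i = v (p i)"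
proof -
  have "w i \<in> vertex_hull d v" if "i \<le> d" for i
    using vertex_mem_hull[of w, OF w(2)[OF that] that] hull by simp
  then obtain P where P: "\<And>i j. i \<le> d \<Longrightarrow> j \<le> d \<Longrightarrow> 0 \<le> P i j"
    "\<And>i. i \<le> d \<Longrightarrow> (\<Sum>j\<le>d. P i j) = 1"
    "\<And>i. i \<le> d \<Longrightarrow> w i = vec d (\<lambda>l. \<Sum>j\<le>d. P i j * v j $ l)"
    using hull_coefficient_matrix[of d w v] by blast
  have "v i \<in> vertex_hull d w" if "i \<le> d" for i
    using vertex_mem_hull[of v, OF v(2)[OF that] that] hull by simp
  then obtain Q where Q: "\<And>i j. i \<le> d \<Longrightarrow> j \<le> d \<Longrightarrow> 0 \<le> Q i j"
    "\<And>i. i \<le> d \<Longrightarrow> (\<Sum>j\<le>d. Q i j) = 1"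
    "\<And>i. i \<le> d \<Longrightarrow> v i = vec d (\<lambda>l. \<Sum>j\<le>d. Q i j * w j $ l)"
    using hull_coefficient_matrix[of d v w] by blast
  \<comment> \<open>Substituting one expression into the other writes \<open>w i\<close> as a
    combination of the family \<open>w\<close> with coefficients from row \<open>i\<close> of
    \<open>P Q\<close>. By uniqueness this row is the \<open>i\<close>-th unit row.\<close>
  have PQ: "(\<Sum>j\<le>d. P i j * Q j k) = (if k = i then 1 else 0)" if "i \<le> d" "k \<le> d" for i k
  proof (rule affinely_independent_coeffs_unique[OF w(1) _ _ that(2)])
    have "(\<Sum>k\<le>d. \<Sum>j\<le>d. P i j * Q j k) = (\<Sum>j\<le>d. P i j * (\<Sum>k\<le>d. Q j k))"
      unfolding sum_distrib_left by (rule sum.swap)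
    then show "(\<Sum>k\<le>d. \<Sum>j\<le>d. P i j * Q j k) = (\<Sum>k\<le>d. if k = i then 1 else 0)"
      using that by (simp add: Q(2) P(2))
    fix l assume l: "l < d"
    have "(\<Sum>k\<le>d. (\<Sum>j\<le>d. P i j * Q j k) * w k $ l) = (\<Sum>j\<le>d. P i j * (\<Sum>k\<le>d. Q j k * w k $ l))"
      unfolding sum_distrib_left sum_distrib_right mult.assoc by (rule sum.swap)
    also have "\<dots> = (\<Sum>j\<le>d. P i j * v j $ l)"
      by (rule sum.cong) (use l in \<open>auto simp: Q(3)\<close>)
    also have "\<dots> = w i $ l"
      using P(3)[OF that(1)] l by simp
    also have "\<dots> = (\<Sum>k\<le>d. (if k = i then 1 else 0) * w k $ l)"
      using that by (simp add: if_distrib[of "\<lambda>t. t * _"] cong: if_cong)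
    finally show "(\<Sum>k\<le>d. (\<Sum>j\<le>d. P i j * Q j k) * w k $ l) =
      (\<Sum>k\<le>d. (if k = i then 1 else 0) * w k $ l)" .
  qed
  have "\<exists>j\<le>d. w i = v j" if i: "i \<le> d" for i
  proof -
    obtain j where j: "j \<le> d" "P i j \<noteq> 0"
      using P(2)[OF i] by (metis atMost_iff sum.neutral zero_neq_one)
    \<comment> \<open>An off-diagonal entry of \<open>P Q\<close> is a vanishing sum of nonnegative
      terms, so every term is zero; since \<open>P i j\<close> is nonzero, the factor
      \<open>Q j k\<close> is zero. Row \<open>j\<close> of \<open>Q\<close> is thus concentrated at
      \<open>i\<close>, which makes \<open>v j\<close> equal to \<open>w i\<close>.\<close>
    have Q0: "Q j k = 0" if "k \<le> d" "k \<noteq> i" for k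
    proof -
      have "(\<Sum>j\<le>d. P i j * Q j k) = 0"
        using PQ[OF i] that by simp
      then have "P i j * Q j k = 0"
        using sum_nonneg_eq_0_iff[of "{..d}" "\<lambda>j. P i j * Q j k"] P(1)[OF i] Q(1) that j by auto
      with j show ?thesis by simp
    qed
    have "(\<Sum>k\<le>d. Q j k) = (\<Sum>k\<in>{i}. Q j k)"
      using i Q0 by (intro sum.mono_neutral_right) auto
    then have "Q j i = 1"
      using Q(2)[OF j(1)] by simp
    have "v j $ l = w i $ l" if "l < d" for l
    proof -
      have "v j $ l = (\<Sum>k\<le>d. Q j k * w k $ l)"
        using Q(3)[OF j(1)] that by simp
      also have "\<dots> = (\<Sum>k\<in>{i}. Q j k * w k $ l)"
        using i Q0 by (intro sum.mono_neutral_right) auto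
      finally show ?thesis using \<open>Q j i = 1\<close> by simp
    qed
    then have "w i = v j"
      using v(2)[OF j(1)] w(2)[OF i] by (intro eq_vecI) auto
    with j show ?thesis by blast
  qed
  then obtain p where p: "\<And>i. i \<le> d \<Longrightarrow> p i \<le> d" "\<And>i. i \<le> d \<Longrightarrow> w i = v (p i)"
    by metis
  have "inj_on p {..d}"
  proof (rule inj_onI)
    fix i k assume ik: "i \<in> {..d}" "k \<in> {..d}" "p i = p k"
    then have eq: "w i = w k" by (simp add: p(2))
    \<comment> \<open>The two unit coefficient families at \<open>i\<close> and \<open>k\<close>
      represent the same point, hence agree; they are compared at the index
      \<open>i\<close>.\<close>
    have "(if i = i then 1 else 0 :: real) = (if i = k then 1 else 0)"
      by (rule affinely_independent_coeffs_unique[OF w(1), of "\<lambda>l. if l = i then 1 else 0"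
            "\<lambda>l. if l = k then 1 else 0"])
        (use ik eq in \<open>auto simp: if_distrib[of "\<lambda>t. t * _"] cong: if_cong\<close>)
    then show "i = k" by (simp split: if_splits)
  qed
  moreover have "p ` {..d} \<subseteq> {..d}"
    using p(1) by auto
  ultimately have "bij_betw p {..d} {..d}"
    by (simp add: bij_betw_def endo_inj_surj)
  with p(2) show thesis by (rule that[rotated])
qed

text \<open>Permuting the coordinates along \<open>p\<close> is an age-preserving bijection between
  the two sets of interior points, since the integrality conditions involve only sums over all
  vertices.\<close>

lemma local_h_star_of_vertices_permute:
  assumes v: "affinely_independent d v" and w: "affinely_independent d w"
    and p: "bij_betw p {..d} {..d}" and wv: "\<And>i. i \<le> d \<Longrightarrow> w i = v (p i)"
  shows "local_h_star_of_vertices d w = local_h_star_of_vertices d v"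
proof -
  define q where "q = inv_into {..d} p"
  have q: "bij_betw q {..d} {..d}"
    unfolding q_def using p by (rule bij_betw_inv_into)
  have pd: "p i \<le> d" if "i \<le> d" for i
    using bij_betwE[OF p] that by auto
  have qd: "q i \<le> d" if "i \<le> d" for i
    using bij_betwE[OF q] that by auto
  have pq: "p (q i) = i" if "i \<le> d" for i
    unfolding q_def using bij_betw_inv_into_right[OF p] that by simp
  have qp: "q (p i) = i" if "i \<le> d" for i
    unfolding q_def using bij_betw_inv_into_left[OF p] that by simp
  have sum_p: "(\<Sum>i\<le>d. f (p i)) = (\<Sum>i\<le>d. f i)" for f :: "nat \<Rightarrow> real"
    by (rule sum.reindex_bij_betw[OF p])
  have sum_q: "(\<Sum>i\<le>d. f (q i)) = (\<Sum>i\<le>d. f i)" for f :: "nat \<Rightarrow> real"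
    by (rule sum.reindex_bij_betw[OF q])
  define perm where "perm r x = vec (d + 1) (\<lambda>i. x $ r i)" for r and x :: "real vec"
  let ?I = "\<lambda>v. {x \<in> simplex_group d v. \<forall>i\<le>d. 0 < x $ i \<and> x $ i < 1}"
  have perm_p: "perm p x \<in> ?I w" if x: "x \<in> ?I v" for x
  proof -
    have idx: "perm p x $ i = x $ p i" if "i \<le> d" for i
      using that by (simp add: perm_def)
    have lat: "x \<in> simplex_lattice d v"
      using x by (simp add: simplex_group_def)
    have "(\<Sum>i\<le>d. perm p x $ i * w i $ j) = (\<Sum>i\<le>d. x $ i * v i $ j)" for j
      using sum_p[of "\<lambda>i. x $ i * v i $ j"] by (simp add: idx wv)
    moreover have "(\<Sum>i\<le>d. perm p x $ i) = (\<Sum>i\<le>d. x $ i)"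
      using sum_p[of "\<lambda>i. x $ i"] by (simp add: idx)
    ultimately have "perm p x \<in> simplex_lattice d w"
      using lat by (simp add: mem_simplex_lattice_iff[OF v] mem_simplex_lattice_iff[OF w])
        (simp add: perm_def)
    then show ?thesis
      using x pd by (auto simp: simplex_group_def idx)
  qed
  have perm_q: "perm q x \<in> ?I v" if x: "x \<in> ?I w" for x
  proof -
    have idx: "perm q x $ i = x $ q i" if "i \<le> d" for i
      using that by (simp add: perm_def)
    have lat: "x \<in> simplex_lattice d w"
      using x by (simp add: simplex_group_def)
    have "(\<Sum>i\<le>d. perm q x $ i * v i $ j) = (\<Sum>i\<le>d. x $ i * w i $ j)" for j
      using sum_q[of "\<lambda>i. x $ i * w i $ j"] by (simp add: idx wv qd pq)
    moreover have "(\<Sum>i\<le>d. perm q x $ i) = (\<Sum>i\<le>d. x $ i)"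
      using sum_q[of "\<lambda>i. x $ i"] by (simp add: idx)
    ultimately have "perm q x \<in> simplex_lattice d v"
      using lat by (simp add: mem_simplex_lattice_iff[OF v] mem_simplex_lattice_iff[OF w])
        (simp add: perm_def)
    then show ?thesis
      using x qd by (auto simp: simplex_group_def idx)
  qed
  have carrier: "x \<in> carrier_vec (d + 1)" if "x \<in> ?I v \<or> x \<in> ?I w" for x
    using that by (auto simp: simplex_group_def mem_simplex_lattice_iff[OF v] mem_simplex_lattice_iff[OF w])
  show ?thesis
    unfolding local_h_star_of_vertices_def
  proof (rule sum.reindex_bij_witness[where i = "perm p" and j = "perm q"])
    fix x assume x: "x \<in> ?I w"
    show "perm p (perm q x) = x"
      using carrier[of x] x by (intro eq_vecI) (auto simp: perm_def qp pd less_Suc_eq_le)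
    show "perm q x \<in> ?I v"
      using x by (rule perm_q)
    have "age d (perm q x) = age d x"
      using sum_q[of "\<lambda>i. x $ i"] by (simp add: age_def perm_def)
    then show "monom 1 (nat \<lfloor>age d (perm q x)\<rfloor>) = monom (1 :: int) (nat \<lfloor>age d x\<rfloor>)"
      by simp
  next
    fix x assume x: "x \<in> ?I v"
    show "perm q (perm p x) = x"
      using carrier[of x] x by (intro eq_vecI) (auto simp: perm_def pq qd less_Suc_eq_le)
    show "perm p x \<in> ?I w"
      using x by (rule perm_p)
  qed
qed

text \<open>Any two enumerations of the vertices of \<open>S\<close> differ by a permutation, so the
  arbitrary choice in \<open>local_h_star\<close> may be replaced by a convenient
  enumeration.\<close>

lemma local_h_star_eq:
  assumes S: "lattice_simplex d S v"
  shows "local_h_star d S = local_h_star_of_vertices d v"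
proof -
  define w where "w = (SOME v. lattice_simplex d S v)"
  have T: "lattice_simplex d S w"
    unfolding w_def using S by (rule someI[of "lattice_simplex d S"])
  obtain p where "bij_betw p {..d} {..d}" "\<And>i. i \<le> d \<Longrightarrow> w i = v (p i)"
    by (rule vertices_unique_up_to_permutation[of d v w])
      (use S T in \<open>auto simp: lattice_simplex_def integer_points_def\<close>)
  then have "local_h_star_of_vertices d w = local_h_star_of_vertices d v"
    using S T by (intro local_h_star_of_vertices_permute) (auto simp: lattice_simplex_def)
  then show ?thesis
    by (simp add: local_h_star_def w_def)
qed

subsection \<open>Two-row Hermite normal form simplices\<close>

text \<open>Among the vertices \<open>0, ..., e\<close> only the unit vector numbered
  \<open>Suc j\<close> has a nonzero component \<open>j\<close>. Writing the dimension as
  \<open>e + 2\<close> avoids truncated subtraction.\<close>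

lemma two_row_hnf_vertex_sum:
  assumes "dim_vec a = e + 2" "dim_vec b = e + 2" "j < e + 2"
  shows "(\<Sum>i\<le>e + 2. c i * two_row_hnf_vertex (e + 2) a b i $ j) =
    (if j < e then c (Suc j) else 0) + c (e + 1) * of_int (b $ j) + c (e + 2) * of_int (a $ j)"
proof -
  have "(\<Sum>i\<le>e. c i * two_row_hnf_vertex (e + 2) a b i $ j) =
    (\<Sum>i\<le>e. if i = Suc j then c i else 0)"
    using assms by (intro sum.cong) (auto simp: two_row_hnf_vertex_def unit_vec_def)
  also have "\<dots> = (if j < e then c (Suc j) else 0)"
    by (auto simp: Suc_le_eq)
  finally show ?thesis
    using assms by (simp add: two_row_hnf_vertex_def)
qed

lemma sum_first_last:
  fixes f :: "nat \<Rightarrow> 'a::comm_monoid_add"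
  shows "(\<Sum>i\<le>e + 2. f i) = f 0 + (\<Sum>i<e. f (Suc i)) + f (e + 1) + f (e + 2)"
proof -
  have "(\<Sum>i\<le>e. f i) = f 0 + (\<Sum>i<e. f (Suc i))"
    by (rule sum.atMost_shift)
  then show ?thesis by (simp add: numeral_2_eq_2)
qed

text \<open>The vertex system is triangular. Component \<open>e + 1\<close> involves only the
  coefficient of \<open>a\<close>, component \<open>e\<close> then only that of \<open>b\<close>,
  the remaining components isolate the unit vectors, and the coefficient sum settles the
  origin.\<close>

lemma lattice_simplex_two_row_hnf:
  assumes "dim_vec a = e + 2" "dim_vec b = e + 2"
    and "a $ (e + 1) \<noteq> 0" "b $ e \<noteq> 0" "b $ (e + 1) = 0"
  shows "lattice_simplex (e + 2) (two_row_hnf_simplex (e + 2) a b) (two_row_hnf_vertex (e + 2) a b)"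
proof -
  have "two_row_hnf_vertex (e + 2) a b i \<in> integer_points (e + 2)" for i
    using assms(1,2)
    by (auto simp: two_row_hnf_vertex_def integer_points_def unit_vec_def intro!: carrier_vecI)
  moreover have "affinely_independent (e + 2) (two_row_hnf_vertex (e + 2) a b)"
    unfolding affinely_independent_def
  proof (intro allI impI, elim conjE)
    fix c :: "nat \<Rightarrow> real" and i
    assume s: "(\<Sum>i\<le>e + 2. c i) = 0"
      and H: "\<forall>j<e + 2. (\<Sum>i\<le>e + 2. c i * two_row_hnf_vertex (e + 2) a b i $ j) = 0"
      and i: "i \<le> e + 2"
    have z: "(if j < e then c (Suc j) else 0) + c (e + 1) * of_int (b $ j)
      + c (e + 2) * of_int (a $ j) = 0" if "j < e + 2" for j
      unfolding two_row_hnf_vertex_sum[OF assms(1,2) that, symmetric] using H that by blast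
    have 2: "c (e + 2) = 0"
      using z[of "e + 1"] assms by simp
    have 1: "c (e + 1) = 0"
      using z[of e] assms 2 by simp
    have m: "c (Suc j) = 0" if "j < e" for j
      using z[of j] that 1 2 by simp
    have 0: "c 0 = 0"
      using s unfolding sum_first_last by (simp only: 1 2 m sum.neutral lessThan_iff) (simp add: m)
    consider "i = 0" | j where "i = Suc j" "j < e" | "i = e + 1" | "i = e + 2"
      using i by (cases i) (auto, linarith)
    then show "c i = 0"
      by cases (simp_all only: 0 1 2 m)
  qed
  ultimately show ?thesis
    by (simp add: lattice_simplex_def two_row_hnf_simplex_def)
qed

text \<open>The difference is an integer strictly between -1 and 1.\<close>

lemma unit_interval_eqI:
  fixes x y :: real
  assumes "x - y \<in> \<int>" "0 \<le> x" "x < 1" "0 \<le> y" "y < 1"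
  shows "x = y"
proof -
  from assms(1) obtain k :: int where k: "x - y = of_int k"
    by (auto elim: Ints_cases)
  then have "of_int k < (1 :: real)" "of_int k > (- 1 :: real)"
    using assms by linarith+
  then have "k = 0" by linarith
  with k show ?thesis by simp
qed

theorem theorem5p11:
  fixes d :: nat and M N :: int and a b :: "int vec"
  assumes "d \<ge> 2" and "N > 1" and "M \<in> {int d - 1, int d}"
    and "a = vec d (\<lambda>i. if i < d - 1 then 1 else N)"
    and "b = vec d (\<lambda>i. if i < d - 2 then M - 1 else if i = d - 2 then M else 0)"
  shows "local_h_star d (two_row_hnf_simplex d a b) =
    (if M = int d - 1 then 0 else smult (N - 1) (\<Sum>i = 1..d. monom 1 i))"
proof -
  obtain e where d: "d = e + 2"
    using assms(1) by (metis add.commute le_Suc_ex)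
  let ?v = "two_row_hnf_vertex d a b"
  let ?I = "{x \<in> simplex_group d ?v. \<forall>i\<le>d. 0 < x $ i \<and> x $ i < 1}"
  have dims: "dim_vec a = e + 2" "dim_vec b = e + 2"
    using assms(4,5) d by auto
  have a_idx: "a $ j = (if j < e + 1 then 1 else N)" if "j < e + 2" for j
    using assms(4) d that by simp
  have b_idx: "b $ j = (if j < e then M - 1 else if j = e then M else 0)" if "j < e + 2" for j
    using assms(5) d that by simp
  have "lattice_simplex d (two_row_hnf_simplex d a b) ?v"
    unfolding d by (rule lattice_simplex_two_row_hnf)
      (use assms(2,3) dims d in \<open>auto simp: a_idx b_idx\<close>)
  then have ind: "affinely_independent d ?v"
    and star: "local_h_star d (two_row_hnf_simplex d a b) = local_h_star_of_vertices d ?v"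
    by (auto simp: lattice_simplex_def local_h_star_eq)
  \<comment> \<open>The three kinds of conditions come from the components \<open>j < e\<close>,
    \<open>j = e\<close> and \<open>j = e + 1\<close> of \<open>x A\<close> after its first
    entry.\<close>
  have lattice_iff: "x \<in> simplex_lattice d ?v \<longleftrightarrow> x \<in> carrier_vec (d + 1) \<and> (\<Sum>i\<le>d. x $ i) \<in> \<int> \<and>
      (\<forall>j<e. x $ Suc j + x $ (e + 1) * of_int (M - 1) + x $ d \<in> \<int>) \<and>
      x $ (e + 1) * of_int M + x $ d \<in> \<int> \<and> x $ d * of_int N \<in> \<int>" for x
  proof -
    have "(\<forall>j<d. (\<Sum>i\<le>d. x $ i * ?v i $ j) \<in> \<int>) \<longleftrightarrow> (\<forall>j<e + 2.
      (if j < e then x $ Suc j else 0) + x $ (e + 1) * of_int (b $ j) + x $ d * of_int (a $ j) \<in> \<int>)"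
      unfolding d by (simp only: two_row_hnf_vertex_sum[OF dims] cong: imp_cong)
    also have "\<dots> \<longleftrightarrow> (\<forall>j<e. x $ Suc j + x $ (e + 1) * of_int (M - 1) + x $ d \<in> \<int>) \<and>
      x $ (e + 1) * of_int M + x $ d \<in> \<int> \<and> x $ d * of_int N \<in> \<int>"
      by (auto simp: a_idx b_idx less_Suc_eq)
    finally show ?thesis
      by (simp add: mem_simplex_lattice_iff[OF ind])
  qed

  \<comment> \<open>Relations between the coordinates of an interior point\<close>
  have mid: "x $ j = x $ (e + 1)" if x: "x \<in> ?I" and j: "1 \<le> j" "j \<le> e + 1" for x j
  proof (cases "j = e + 1")
    case False
    then obtain i where i: "j = Suc i" "i < e"
      using j by (cases j) auto
    \<comment> \<open>Subtracting the condition of component \<open>e\<close> from that of component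
      \<open>i\<close> cancels \<open>x $ d\<close> and leaves just
      \<open>x $ j - x $ (e + 1)\<close>.\<close>
    have "x $ j + x $ (e + 1) * of_int (M - 1) + x $ d - (x $ (e + 1) * of_int M + x $ d) \<in> \<int>"
      using x i by (intro Ints_diff) (auto simp: simplex_group_def lattice_iff)
    then have "x $ j - x $ (e + 1) \<in> \<int>"
      by (simp add: algebra_simps)
    then show ?thesis
      using x j d by (intro unit_interval_eqI) (auto simp: less_imp_le)
  qed simp
  have age_eq: "age d x = x $ 0 + of_nat (e + 1) * x $ (e + 1) + x $ d" if "x \<in> ?I" for x
  proof -
    have "(\<Sum>i<e. x $ Suc i) = (\<Sum>i<e. x $ (e + 1))"
    proof (rule sum.cong[OF refl])
      fix i assume "i \<in> {..<e}"
      then show "x $ Suc i = x $ (e + 1)"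
        using mid[OF that, of "Suc i"] by simp
    qed
    then show ?thesis
      unfolding age_def d sum_first_last by (simp add: algebra_simps)
  qed
  \<comment> \<open>The age minus the condition of component \<open>e\<close> eliminates
    \<open>x $ d\<close>. The remaining coefficient \<open>e + 1 - M\<close> is 0 for
    \<open>M = d - 1\<close> and -1 for \<open>M = d\<close>.\<close>
  have int_first: "x $ 0 + (of_nat (e + 1) - of_int M) * x $ (e + 1) \<in> \<int>" if x: "x \<in> ?I" for x
  proof -
    have "age d x \<in> \<int>" "x $ (e + 1) * of_int M + x $ d \<in> \<int>"
      using x by (auto simp: simplex_group_def lattice_iff age_def)
    then have "age d x - (x $ (e + 1) * of_int M + x $ d) \<in> \<int>"
      by (rule Ints_diff)
    then show ?thesis
      using age_eq[OF x] by (simp add: algebra_simps)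
  qed
  show ?thesis
  proof (cases "M = int d - 1")
    case True
    have "?I = {}"
    proof (rule equals0I)
      fix x assume x: "x \<in> ?I"
      then have "x $ 0 \<in> \<int>"
        using int_first[OF x] True d by simp
      then have "x $ 0 = 0"
        using x by (intro unit_interval_eqI) auto
      with x show False by auto
    qed
    then show ?thesis
      unfolding star local_h_star_of_vertices_def by (simp only: True sum.empty if_True refl)
  next
    case False

    \<comment> \<open>Enumeration of the interior points in the case \<open>M = d\<close>\<close>
    then have M: "M = int d"
      using assms(3) by simp
    \<comment> \<open>The last coordinate is \<open>k / N\<close>; the common value of the other
      \<open>d\<close> coordinates is chosen to make the coordinate sum equal to
      \<open>i\<close>.\<close>
    define pt where "pt i k = vec (d + 1) (\<lambda>j. if j < d
      then (of_nat i - of_int k / of_int N) / of_nat d else of_int k / of_int N :: real)"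
      for i :: nat and k :: int
    have pt_idx: "pt i k $ j = (if j < d
      then (of_nat i - of_int k / of_int N) / of_nat d else of_int k / of_int N)" if "j \<le> d" for i k j
      using that by (simp add: pt_def)
    have sum_pt: "(\<Sum>j\<le>d. pt i k $ j) = of_nat i" for i k
    proof -
      have "(\<Sum>j\<le>d. pt i k $ j) = (\<Sum>j<d. pt i k $ j) + pt i k $ d"
        by (simp flip: lessThan_Suc_atMost)
      also have "\<dots> = of_nat i"
        using d by (simp add: pt_idx)
      finally show ?thesis .
    qed
    have pt_mem: "pt i k \<in> ?I" if i: "1 \<le> i" "i \<le> d" and k: "1 \<le> k" "k < N" for i k
    proof -
      let ?z = "of_int k / of_int N :: real"
      have z: "0 < ?z" "?z < 1"
        using k by auto
      \<comment> \<open>From \<open>1 \<le> i \<le> d\<close> and \<open>0 < ?z < 1\<close> it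
        follows that \<open>i - ?z\<close> lies strictly between 0 and \<open>d\<close>.\<close>
      have y: "0 < (of_nat i - ?z) / of_nat d" "(of_nat i - ?z) / of_nat d < 1"
        using z i d by (auto simp: field_simps simp del: of_nat_add)
      \<comment> \<open>Because \<open>M = d\<close>, the conditions of the components
        \<open>j < e\<close> and \<open>j = e\<close> both have this integer as their value.\<close>
      have eq: "(of_nat i - ?z) / of_nat d * of_nat d + ?z = of_nat i"
        using d by simp
      have "pt i k \<in> simplex_lattice d ?v"
        unfolding lattice_iff sum_pt
      proof (intro conjI allI impI)
        fix j assume j: "j < e"
        have "pt i k $ Suc j + pt i k $ (e + 1) * of_int (M - 1) + pt i k $ d =
          (of_nat i - ?z) / of_nat d * of_nat d + ?z"
        proof -
          have "y + y * of_int (M - 1) = y * of_nat d" for y :: real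
            by (simp add: M algebra_simps)
          moreover have "pt i k $ Suc j = (of_nat i - ?z) / of_nat d"
            "pt i k $ (e + 1) = (of_nat i - ?z) / of_nat d" "pt i k $ d = ?z"
            using j d by (simp_all add: pt_idx)
          ultimately show ?thesis
            by (simp only:)
        qed
        then show "pt i k $ Suc j + pt i k $ (e + 1) * of_int (M - 1) + pt i k $ d \<in> \<int>"
          unfolding eq by simp
      next
        have "pt i k $ (e + 1) * of_int M + pt i k $ d = (of_nat i - ?z) / of_nat d * of_nat d + ?z"
          using d by (simp add: pt_idx M)
        then show "pt i k $ (e + 1) * of_int M + pt i k $ d \<in> \<int>"
          unfolding eq by simp
      qed (use assms(2) in \<open>auto simp: pt_idx intro!: carrier_vecI\<close>, simp add: pt_def)
      then show ?thesis
        using y z by (auto simp: simplex_group_def pt_idx less_imp_le)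
    qed
    \<comment> \<open>The last coordinate recovers \<open>k\<close>, and the coordinate sum recovers
      \<open>i\<close>.\<close>
    have pt_inj: "inj_on (\<lambda>(i, k). pt i k) ({1..d} \<times> {1..<N})"
    proof (rule inj_onI, clarify)
      fix i k i' k' assume eq: "pt i k = pt i' k'"
      then have "pt i k $ d = pt i' k' $ d" by simp
      then have "k = k'"
        using assms(2) by (simp add: pt_idx)
      moreover have "real i = real i'"
        using eq sum_pt by metis
      ultimately show "i = i' \<and> k = k'" by simp
    qed
    have pt_surj: "x \<in> (\<lambda>(i, k). pt i k) ` ({1..d} \<times> {1..<N})" if x: "x \<in> ?I" for x
    proof -
      have bounds: "0 < x $ j" "x $ j < 1" if "j \<le> d" for j
        using x that by auto
      have "x $ 0 - x $ (e + 1) \<in> \<int>"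
        using int_first[OF x] M d by (simp add: algebra_simps)
      then have zero: "x $ 0 = x $ (e + 1)"
        using bounds[of 0] bounds[of "e + 1"] d by (intro unit_interval_eqI) auto
      have const: "x $ j = x $ 0" if "j < d" for j
        using mid[OF x, of j] zero that d by (cases "j = 0") auto
      have lat: "x \<in> carrier_vec (d + 1)" "age d x \<in> \<int>" "x $ d * of_int N \<in> \<int>"
        using x by (auto simp: simplex_group_def lattice_iff age_def)
      have age: "age d x = of_nat d * x $ 0 + x $ d"
        using age_eq[OF x] zero d by (simp add: algebra_simps)
      obtain s :: int where s: "age d x = of_int s"
        using lat(2) by (auto elim: Ints_cases)
      obtain k :: int where k: "x $ d * of_int N = of_int k"
        using lat(3) by (auto elim: Ints_cases)
      \<comment> \<open>The age is \<open>d * x $ 0 + x $ d\<close>, with summands in the open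
        intervals from 0 to \<open>d\<close> and from 0 to 1, so the integer \<open>s\<close> lies
        between 1 and \<open>d\<close>.\<close>
      have "0 < of_nat d * x $ 0" "of_nat d * x $ 0 < of_nat d"
        using bounds[of 0] d by auto
      then have "0 < real_of_int s" "real_of_int s < of_nat d + 1"
        using s age bounds[of d] by linarith+
      then have s_bounds: "1 \<le> s" "s \<le> int d"
        by linarith+
      have N: "0 < real_of_int N"
        using assms(2) by simp
      have "0 < real_of_int k" "real_of_int k < of_int N"
        using bounds[of d] N unfolding k[symmetric] by auto
      then have k_bounds: "1 \<le> k" "k < N"
        by linarith+
      have xd: "x $ d = of_int k / of_int N"
        using k N by (simp add: field_simps)
      have x0: "x $ 0 = (of_int s - of_int k / of_int N) / of_nat d"
        using s age xd d by (simp add: field_simps del: of_nat_add)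
      have "x = pt (nat s) k"
      proof (rule eq_vecI)
        fix j assume "j < dim_vec (pt (nat s) k)"
        then have "j < d \<or> j = d"
          by (auto simp: pt_def)
        then show "x $ j = pt (nat s) k $ j"
          using const[of j] x0 xd s_bounds by (auto simp: pt_idx)
      qed (use lat(1) in \<open>simp add: pt_def\<close>)
      then show ?thesis
        using s_bounds k_bounds by (intro image_eqI[of _ _ "(nat s, k)"]) auto
    qed
    have I: "?I = (\<lambda>(i, k). pt i k) ` ({1..d} \<times> {1..<N})"
      using pt_mem pt_surj by auto
    have "local_h_star_of_vertices d ?v =
      (\<Sum>(i, k)\<in>{1..d} \<times> {1..<N}. monom 1 (nat \<lfloor>age d (pt i k)\<rfloor>))"
      unfolding local_h_star_of_vertices_def I sum.reindex[OF pt_inj]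
      by (simp add: case_prod_unfold comp_def)
    also have "\<dots> = (\<Sum>(i, k)\<in>{1..d} \<times> {1..<N}. monom 1 i)"
      by (simp add: age_def sum_pt)
    also have "\<dots> = (\<Sum>i = 1..d. \<Sum>k\<in>{1..<N}. monom 1 i)"
      by (rule sum.cartesian_product[symmetric])
    \<comment> \<open>The inner sum is constant over the \<open>N - 1\<close> values of
      \<open>k\<close>.\<close>
    also have "\<dots> = (\<Sum>i = 1..d. smult (N - 1) (monom 1 i))"
      using assms(2) by (simp add: of_nat_poly)
    also have "\<dots> = smult (N - 1) (\<Sum>i = 1..d. monom 1 i)"
      by (rule poly_eqI) (simp only: coeff_sum coeff_smult sum_distrib_left)
    finally show ?thesis
      using False star by simp
  qed
qed

end
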